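(* Let $R$ be a commutative ring with identity such that $2\in R^\times$ and let $C\in\operatorname{Mat}_2(R)$ be cyclic. Let $F\in\operatorname{GL}_2(R)$, let $K_1,\dots,K_m\in\operatorname{Orb}(C)$, and put $G_i=FK_i$ for $i=1,\dots,m$. Assume that either (1) the family $K_1,\dots,K_m$ is affinely saturated, or (2) $\operatorname{tr}(C)=0$ and the family $K_1,\dots,K_m$ is linearly saturated. Then $$\{U^{-1}:U\in\operatorname{Cons}_C(G_1,\ldots,G_m)\}=F\,\Gamma_C(R).$$ Consequently, the finite translated sample $G_1,\dots,G_m$ determines exactly the same multiplier class as the complete translated orbit $F\operatorname{Orb}(C)$, i.e. $$\{U^{-1}:U\in\operatorname{Cons}_C(G_1,\ldots,G_m)\}=\{F'\in\operatorname{GL}_2(R):F'\operatorname{Orb}(C)=F\operatorname{Orb}(C)\}.$$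
   Context: A matrix $C\in\operatorname{Mat}_2(R)$ is cyclic if there exists $v\in R^2$ such that $(v,Cv)$ is an $R$-basis of $R^2$. $\operatorname{Orb}(C)=\{PCP^{-1}:P\in\operatorname{GL}_2(R)\}$, $F\operatorname{Orb}(C)=\{FK:K\in\operatorname{Orb}(C)\}$, and $\mathfrak{sl}_2(R)=\{X\in\operatorname{Mat}_2(R):\operatorname{tr}(X)=0\}$. A family $K_1,\dots,K_m\in\operatorname{Orb}(C)$ (with $m\ge 1$) is affinely saturated if $\operatorname{span}_R\{K_i-K_1:i=2,\ldots,m\}=\mathfrak{sl}_2(R)$. If $\operatorname{tr}(C)=0$, it is linearly saturated if $\operatorname{span}_R\{K_1,\ldots,K_m\}=\mathfrak{sl}_2(R)$. The left stabilizer is $\Gamma_C(R):=\{H\in\operatorname{GL}_2(R):H\operatorname{Orb}(C)=\operatorname{Orb}(C)\}$. The orbit-consistency set is $\operatorname{Cons}_C(G_1,\ldots,G_m):=\{U\in\operatorname{GL}_2(R):UG_i\in\operatorname{Orb}(C)\text{ for all }i\}$. *)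

theory Defs
  imports "HOL-Analysis.Analysis"
begin

lemma module_vector_scalar_mult:
  "module ((*s) :: 'a::comm_ring_1 \<Rightarrow> 'a ^ 'n \<Rightarrow> 'a ^ 'n)"
  by unfold_locales
     (simp_all add: vector_add_ldistrib vector_sadd_rdistrib vector_smult_assoc)

text \<open>The library's \<open>*s\<close> on \<open>'a ^ 2 ^ 2\<close> would take scalars in \<open>'a ^ 2\<close>, so the
  \<open>'a\<close>-module structure on matrices needs its own scalar multiplication.\<close>

definition mat_smult :: "'a::comm_ring_1 \<Rightarrow> 'a ^ 2 ^ 2 \<Rightarrow> 'a ^ 2 ^ 2" where
  "mat_smult c A = map_matrix ((*) c) A"

lemma module_mat_smult: "module (mat_smult :: 'a::comm_ring_1 \<Rightarrow> _)"
  by unfold_locales (simp_all add: mat_smult_def vec_eq_iff algebra_simps)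

definition GL2 :: "('a::comm_ring_1 ^ 2 ^ 2) set" where
  "GL2 = {P. invertible P}"

definition sl2 :: "('a::comm_ring_1 ^ 2 ^ 2) set" where
  "sl2 = {X. trace X = 0}"

text \<open>\<open>module.dependent\<close> and \<open>module.span\<close> speak about sets of vectors; the condition
  \<open>v \<noteq> w\<close> makes this the basis property of the family \<open>(v, w)\<close>.\<close>

definition basis_pair :: "'a::comm_ring_1 ^ 2 \<Rightarrow> 'a ^ 2 \<Rightarrow> bool" where
  "basis_pair v w \<longleftrightarrow>
     v \<noteq> w \<and> \<not> module.dependent (*s) {v, w} \<and> module.span (*s) {v, w} = UNIV"

definition cyclic_mat :: "'a::comm_ring_1 ^ 2 ^ 2 \<Rightarrow> bool" where
  "cyclic_mat C \<longleftrightarrow> (\<exists>v. basis_pair v (C *v v))"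

definition Orb :: "'a::comm_ring_1 ^ 2 ^ 2 \<Rightarrow> ('a ^ 2 ^ 2) set" where
  "Orb C = {P ** C ** matrix_inv P | P. P \<in> GL2}"

definition left_translate :: "'a::comm_ring_1 ^ 2 ^ 2 \<Rightarrow> ('a ^ 2 ^ 2) set \<Rightarrow> ('a ^ 2 ^ 2) set" where
  "left_translate F S = {F ** K | K. K \<in> S}"

text \<open>Families \<open>K\<^sub>1, \<dots>, K\<^sub>m\<close> are functions on \<open>nat\<close> of which only the values on
  \<open>{1..m}\<close> matter.\<close>

definition affinely_saturated :: "nat \<Rightarrow> (nat \<Rightarrow> 'a::comm_ring_1 ^ 2 ^ 2) \<Rightarrow> bool" where
  "affinely_saturated m K \<longleftrightarrow> module.span mat_smult {K i - K 1 | i. i \<in> {2..m}} = sl2"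

definition linearly_saturated :: "nat \<Rightarrow> (nat \<Rightarrow> 'a::comm_ring_1 ^ 2 ^ 2) \<Rightarrow> bool" where
  "linearly_saturated m K \<longleftrightarrow> module.span mat_smult {K i | i. i \<in> {1..m}} = sl2"

definition left_stabilizer :: "'a::comm_ring_1 ^ 2 ^ 2 \<Rightarrow> ('a ^ 2 ^ 2) set" where
  "left_stabilizer C = {H \<in> GL2. left_translate H (Orb C) = Orb C}"

definition orbit_Cons :: "'a::comm_ring_1 ^ 2 ^ 2 \<Rightarrow> nat \<Rightarrow> (nat \<Rightarrow> 'a ^ 2 ^ 2) \<Rightarrow> ('a ^ 2 ^ 2) set" where
  "orbit_Cons C m G = {U \<in> GL2. \<forall>i\<in>{1..m}. U ** G i \<in> Orb C}"

end

theory Submission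
  imports Defs
begin

text \<open>
  The multiplier class \<open>{F' \<in> GL2. F' Orb(C) = F Orb(C)}\<close> is the coset
  \<open>F \<Gamma>\<^sub>C\<close>. Since \<open>U G\<^sub>i = (U F) K\<^sub>i\<close>, the corollary therefore amounts to this
  rigidity statement (\<open>sample_determines_left_stabilizer\<close>): an invertible \<open>H\<close> that keeps
  all the sample points \<open>K\<^sub>i\<close> in the orbit stabilizes the whole orbit.

  Traces force the rigidity. Conjugate matrices have equal traces, so
  \<open>tr (H K\<^sub>i) = tr C\<close> for every \<open>i\<close>, and the linear functional
  \<open>X \<mapsto> tr (H X)\<close> vanishes on the differences \<open>K\<^sub>i - K\<^sub>1\<close>, and on the
  \<open>K\<^sub>i\<close> themselves when \<open>tr C = 0\<close>. Saturation says that these matrices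
  span \<open>sl2\<close>, so the functional vanishes on \<open>sl2\<close>. Only scalar matrices \<open>H\<close>
  have this property (\<open>scalar_if_trace_orthogonal_sl2\<close>). Multiplication by an
  invertible scalar commutes with every conjugation, so once it takes a single orbit point
  into the orbit, it maps the orbit onto itself
  (\<open>central_left_translate_orbit\<close>).
\<close>

section \<open>Invertible matrices and left translates\<close>

lemma matrix_inv_if_GL2:
  assumes "P \<in> GL2"
  shows "P ** matrix_inv P = mat 1" "matrix_inv P ** P = mat 1"
proof -
  have "\<exists>Q. P ** Q = mat 1 \<and> Q ** P = mat 1"
    using assms by (simp add: GL2_def invertible_def)
  then have "P ** matrix_inv P = mat 1 \<and> matrix_inv P ** P = mat 1"
    unfolding matrix_inv_def by (rule someI_ex)
  then show "P ** matrix_inv P = mat 1" "matrix_inv P ** P = mat 1"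
    by simp_all
qed

lemma GL2_matrix_inv: "P \<in> GL2 \<Longrightarrow> matrix_inv P \<in> GL2"
  using matrix_inv_if_GL2[of P] by (auto simp: GL2_def invertible_def)

lemma GL2_mult: "P \<in> GL2 \<Longrightarrow> Q \<in> GL2 \<Longrightarrow> P ** Q \<in> GL2"
  by (simp add: GL2_def invertible_mult)

lemma matrix_inv_eqI:
  fixes P Q :: "'a::comm_ring_1 ^ 2 ^ 2"
  assumes "P ** Q = mat 1" "Q ** P = mat 1"
  shows "matrix_inv P = Q"
proof -
  have "P \<in> GL2"
    using assms by (auto simp: GL2_def invertible_def)
  then have "matrix_inv P = matrix_inv P ** (P ** Q)"
    using assms by simp
  also have "\<dots> = Q"
    using \<open>P \<in> GL2\<close> by (simp add: matrix_mul_assoc matrix_inv_if_GL2)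
  finally show ?thesis .
qed

lemma matrix_inv_matrix_inv_GL2: "P \<in> GL2 \<Longrightarrow> matrix_inv (matrix_inv P) = P"
  by (simp add: matrix_inv_eqI matrix_inv_if_GL2)

lemma matrix_inv_mult_GL2:
  assumes "P \<in> GL2" "Q \<in> GL2"
  shows "matrix_inv (P ** Q) = matrix_inv Q ** matrix_inv P"
proof (rule matrix_inv_eqI)
  have "P ** Q ** (matrix_inv Q ** matrix_inv P) = P ** (Q ** matrix_inv Q) ** matrix_inv P"
    by (simp add: matrix_mul_assoc)
  then show "P ** Q ** (matrix_inv Q ** matrix_inv P) = mat 1"
    using assms by (simp add: matrix_inv_if_GL2)
  have "matrix_inv Q ** matrix_inv P ** (P ** Q) = matrix_inv Q ** (matrix_inv P ** P) ** Q"
    by (simp add: matrix_mul_assoc)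
  then show "matrix_inv Q ** matrix_inv P ** (P ** Q) = mat 1"
    using assms by (simp add: matrix_inv_if_GL2)
qed

lemma left_translate_mult:
  "left_translate (A ** B) S = left_translate A (left_translate B S)"
  by (simp add: left_translate_def setcompr_eq_image image_image matrix_mul_assoc)

lemma left_translate_one: "left_translate (mat 1) S = S"
  by (simp add: left_translate_def)

lemma left_translate_eq_iff:
  assumes "P \<in> GL2"
  shows "left_translate P S = T \<longleftrightarrow> S = left_translate (matrix_inv P) T"
proof -
  have "left_translate (matrix_inv P) (left_translate P S) = S"
    "left_translate P (left_translate (matrix_inv P) T) = T"
    using assms
    by (simp_all add: left_translate_mult[symmetric] left_translate_one matrix_inv_if_GL2)
  then show ?thesis
    by auto
qed

section \<open>Similarity orbits\<close>

lemma trace_Orb: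
  assumes "X \<in> Orb C"
  shows "trace X = trace C"
proof -
  obtain P where P: "P \<in> GL2" and X: "X = P ** C ** matrix_inv P"
    using assms by (auto simp: Orb_def)
  have "trace X = trace (matrix_inv P ** (P ** C))"
    unfolding X by (rule trace_mul_sym)
  also have "\<dots> = trace C"
    using P by (simp add: matrix_mul_assoc matrix_inv_if_GL2)
  finally show ?thesis .
qed

lemma Orb_conjugate:
  assumes "X \<in> Orb C" "Q \<in> GL2"
  shows "Q ** X ** matrix_inv Q \<in> Orb C"
proof -
  obtain P where P: "P \<in> GL2" and X: "X = P ** C ** matrix_inv P"
    using assms by (auto simp: Orb_def)
  have "Q ** X ** matrix_inv Q = (Q ** P) ** C ** matrix_inv (Q ** P)"
    using P assms(2) by (simp add: X matrix_inv_mult_GL2 matrix_mul_assoc)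
  then show ?thesis
    using GL2_mult[OF assms(2) P] by (auto simp: Orb_def)
qed

lemma Orb_transitive:
  assumes "X \<in> Orb C" "Y \<in> Orb C"
  obtains Q where "Q \<in> GL2" "Y = Q ** X ** matrix_inv Q"
proof -
  obtain P where P: "P \<in> GL2" and X: "X = P ** C ** matrix_inv P"
    using assms by (auto simp: Orb_def)
  obtain R where R: "R \<in> GL2" and Y: "Y = R ** C ** matrix_inv R"
    using assms by (auto simp: Orb_def)
  let ?Q = "R ** matrix_inv P"
  have "?Q ** X ** matrix_inv ?Q
      = R ** (matrix_inv P ** P) ** C ** (matrix_inv P ** P) ** matrix_inv R"
    using P R by (simp add: X matrix_inv_mult_GL2 GL2_matrix_inv matrix_inv_matrix_inv_GL2
        matrix_mul_assoc)
  also have "\<dots> = Y"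
    using P by (simp add: Y matrix_inv_if_GL2)
  finally show thesis
    using that[of ?Q] P R by (simp add: GL2_mult GL2_matrix_inv)
qed

text \<open>Every orbit point is \<open>Y = Q X Q\<^sup>-\<^sup>1\<close>, and as \<open>H\<close> is central, \<open>H Y\<close> is
  the conjugate by \<open>Q\<close> of \<open>H X\<close>. Stated for central \<open>H\<close>, the inclusion
  also applies to \<open>H\<^sup>-\<^sup>1\<close>, which moves the orbit point \<open>H X\<close> to \<open>X\<close>.\<close>

lemma central_left_translate_orbit_subset:
  assumes central: "\<And>A. H ** A = A ** H"
    and "X \<in> Orb C" "H ** X \<in> Orb C"
  shows "left_translate H (Orb C) \<subseteq> Orb C"
proof -
  have "H ** Y \<in> Orb C" if Y: "Y \<in> Orb C" for Y
  proof -
    obtain Q where Q: "Q \<in> GL2" "Y = Q ** X ** matrix_inv Q"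
      using Orb_transitive[OF \<open>X \<in> Orb C\<close> Y] .
    have "H ** Y = (H ** Q) ** X ** matrix_inv Q"
      by (simp add: Q matrix_mul_assoc)
    also have "\<dots> = Q ** (H ** X) ** matrix_inv Q"
      by (simp add: central[of Q] matrix_mul_assoc)
    finally show ?thesis
      using Orb_conjugate[OF \<open>H ** X \<in> Orb C\<close> Q(1)] by simp
  qed
  then show ?thesis
    by (auto simp: left_translate_def)
qed

lemma central_left_translate_orbit:
  assumes H: "H \<in> GL2"
    and central: "\<And>A. H ** A = A ** H"
    and X: "X \<in> Orb C" "H ** X \<in> Orb C"
  shows "left_translate H (Orb C) = Orb C"
proof
  show "left_translate H (Orb C) \<subseteq> Orb C"
    using central X by (rule central_left_translate_orbit_subset)
  let ?H' = "matrix_inv H"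
  have central': "?H' ** A = A ** ?H'" for A
  proof -
    have "?H' ** A = ?H' ** A ** (H ** ?H')"
      using H by (simp add: matrix_inv_if_GL2)
    also have "\<dots> = ?H' ** (A ** H) ** ?H'"
      by (simp add: matrix_mul_assoc)
    also have "\<dots> = (?H' ** H) ** A ** ?H'"
      by (simp add: central[of A, symmetric] matrix_mul_assoc)
    also have "\<dots> = A ** ?H'"
      using H by (simp add: matrix_inv_if_GL2)
    finally show ?thesis .
  qed
  have "?H' ** (H ** X) = X"
    using H by (simp add: matrix_mul_assoc matrix_inv_if_GL2)
  then have "left_translate ?H' (Orb C) \<subseteq> Orb C"
    using central_left_translate_orbit_subset[OF central' X(2)] X(1) by simp
  then have "left_translate H (left_translate ?H' (Orb C)) \<subseteq> left_translate H (Orb C)"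
    by (auto simp: left_translate_def)
  then show "Orb C \<subseteq> left_translate H (Orb C)"
    using H by (simp add: left_translate_mult[symmetric] left_translate_one matrix_inv_if_GL2)
qed

section \<open>Rigidity of saturated families\<close>

text \<open>Taking \<open>X\<close> to be the matrix units \<open>E\<^sub>1\<^sub>2\<close> and
  \<open>E\<^sub>2\<^sub>1\<close> in \<open>tr (H X)\<close> reads off the off-diagonal entries of \<open>H\<close>, and
  \<open>E\<^sub>1\<^sub>1 - E\<^sub>2\<^sub>2\<close> gives the difference of its diagonal entries.\<close>

lemma scalar_if_trace_orthogonal_sl2:
  fixes H :: "'a::comm_ring_1 ^ 2 ^ 2"
  assumes orth: "\<And>X. X \<in> sl2 \<Longrightarrow> trace (H ** X) = 0"
  shows "H = mat (H $ 1 $ 1)"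
proof -
  have "H $ 1 $ 1 * a + H $ 1 $ 2 * c + (H $ 2 $ 1 * b - H $ 2 $ 2 * a) = 0" for a b c
  proof -
    let ?X = "vector [vector [a, b], vector [c, - a]] :: 'a ^ 2 ^ 2"
    have "?X \<in> sl2"
      by (simp add: sl2_def trace_def sum_2)
    from orth[OF this] show ?thesis
      by (simp add: trace_def sum_2 matrix_matrix_mult_def)
  qed
  from this[of 0 0 1] this[of 0 1 0] this[of 1 0 0] show ?thesis
    by (simp add: vec_eq_iff forall_2 mat_def)
qed

lemma scalar_central:
  fixes A :: "'a::comm_ring_1 ^ 2 ^ 2"
  shows "mat h ** A = A ** mat h"
  by (simp add: vec_eq_iff forall_2 mat_def matrix_matrix_mult_def sum_2 mult.commute)

lemma trace_mult_vanishes_on_span: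
  fixes H :: "'a::comm_ring_1 ^ 2 ^ 2"
  assumes "\<And>X. X \<in> S \<Longrightarrow> trace (H ** X) = 0" "X \<in> module.span mat_smult S"
  shows "trace (H ** X) = 0"
proof -
  have "module.subspace mat_smult {X. trace (H ** X) = 0}"
    unfolding module.subspace_def[OF module_mat_smult]
  proof safe
    fix x y assume "trace (H ** x) = 0" "trace (H ** y) = 0"
    then show "trace (H ** (x + y)) = 0"
      by (simp add: matrix_add_ldistrib trace_add)
  next
    fix c x assume "trace (H ** x) = 0"
    moreover have "trace (H ** mat_smult c x) = c * trace (H ** x)"
      by (simp add: mat_smult_def trace_def sum_2 matrix_matrix_mult_def map_matrix_def
          algebra_simps)
    ultimately show "trace (H ** mat_smult c x) = 0"
      by simp
  qed (simp add: trace_def)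
  moreover have "S \<subseteq> {X. trace (H ** X) = 0}"
    using assms(1) by auto
  ultimately have "module.span mat_smult S \<subseteq> {X. trace (H ** X) = 0}"
    using module.span_minimal[OF module_mat_smult] by blast
  then show ?thesis
    using assms(2) by blast
qed

lemma sample_determines_left_stabilizer:
  assumes "1 \<le> m"
    and K: "\<And>i. i \<in> {1..m} \<Longrightarrow> K i \<in> Orb C"
    and saturated: "affinely_saturated m K \<or> (trace C = 0 \<and> linearly_saturated m K)"
    and H: "H \<in> GL2"
  shows "H \<in> left_stabilizer C \<longleftrightarrow> (\<forall>i\<in>{1..m}. H ** K i \<in> Orb C)"
proof
  assume "H \<in> left_stabilizer C"
  then have stable: "left_translate H (Orb C) = Orb C"
    by (simp add: left_stabilizer_def)
  show "\<forall>i\<in>{1..m}. H ** K i \<in> Orb C"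
  proof
    fix i assume "i \<in> {1..m}"
    then have "H ** K i \<in> left_translate H (Orb C)"
      using K by (auto simp: left_translate_def)
    then show "H ** K i \<in> Orb C"
      by (simp add: stable)
  qed
next
  assume HK: "\<forall>i\<in>{1..m}. H ** K i \<in> Orb C"
  then have tr: "trace (H ** K i) = trace C" if "i \<in> {1..m}" for i
    using that trace_Orb by blast
  have "trace (H ** X) = 0" if "X \<in> sl2" for X
    using saturated
  proof
    assume "affinely_saturated m K"
    then have "X \<in> module.span mat_smult {K i - K 1 | i. i \<in> {2..m}}"
      using that by (simp add: affinely_saturated_def)
    then show ?thesis
    proof (rule trace_mult_vanishes_on_span[rotated])
      fix Y assume "Y \<in> {K i - K 1 | i. i \<in> {2..m}}"
      then obtain i where "i \<in> {2..m}" "Y = K i - K 1"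
        by blast
      then have "trace (H ** K i) = trace (H ** Y) + trace (H ** K 1)"
        by (simp add: trace_add[symmetric] matrix_add_ldistrib[symmetric])
      then show "trace (H ** Y) = 0"
        using tr[of i] tr[of 1] \<open>1 \<le> m\<close> \<open>i \<in> {2..m}\<close> by simp
    qed
  next
    assume "trace C = 0 \<and> linearly_saturated m K"
    then have "trace C = 0" "X \<in> module.span mat_smult {K i | i. i \<in> {1..m}}"
      using that by (simp_all add: linearly_saturated_def)
    then show ?thesis
      using tr by (auto intro: trace_mult_vanishes_on_span[rotated])
  qed
  then obtain h where "H = mat h"
    using scalar_if_trace_orthogonal_sl2 by blast
  then have "H ** A = A ** H" for A
    by (simp only: scalar_central)
  moreover have "K 1 \<in> Orb C" "H ** K 1 \<in> Orb C"
    using K HK \<open>1 \<le> m\<close> by simp_all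
  ultimately have "left_translate H (Orb C) = Orb C"
    using H by (intro central_left_translate_orbit)
  then show "H \<in> left_stabilizer C"
    using H by (simp add: left_stabilizer_def)
qed

section \<open>The multiplier class\<close>

lemma left_translate_left_stabilizer:
  assumes F: "F \<in> GL2"
  shows "left_translate F (left_stabilizer C)
    = {F' \<in> GL2. left_translate F' (Orb C) = left_translate F (Orb C)}" (is "?L = ?R")
proof
  show "?L \<subseteq> ?R"
  proof
    fix F' assume "F' \<in> ?L"
    then obtain H where "H \<in> GL2" "left_translate H (Orb C) = Orb C" "F' = F ** H"
      by (auto simp: left_translate_def[of F] left_stabilizer_def)
    then show "F' \<in> ?R"
      using F by (simp add: GL2_mult left_translate_mult)
  qed
next
  show "?R \<subseteq> ?L"
  proof
    fix F' assume F': "F' \<in> ?R"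
    let ?H = "matrix_inv F ** F'"
    have "left_translate ?H (Orb C) = left_translate (matrix_inv F) (left_translate F (Orb C))"
      using F' by (simp add: left_translate_mult)
    also have "\<dots> = Orb C"
      using left_translate_eq_iff[OF F] by blast
    finally have "?H \<in> left_stabilizer C"
      using F F' by (simp add: left_stabilizer_def GL2_mult GL2_matrix_inv)
    moreover have "F' = F ** ?H"
      using F by (simp add: matrix_mul_assoc matrix_inv_if_GL2)
    ultimately show "F' \<in> ?L"
      by (auto simp: left_translate_def[of F])
  qed
qed

theorem corollary3p8:
  fixes C F :: "'a::comm_ring_1 ^ 2 ^ 2"
    and K G :: "nat \<Rightarrow> 'a ^ 2 ^ 2"
    and m :: nat
  assumes two_unit: "(2::'a) dvd 1"
    and C_cyclic: "cyclic_mat C"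
    and F_GL2: "F \<in> GL2"
    and m_pos: "1 \<le> m"
    and K_Orb: "\<And>i. i \<in> {1..m} \<Longrightarrow> K i \<in> Orb C"
    and G_def: "\<And>i. i \<in> {1..m} \<Longrightarrow> G i = F ** K i"
    and saturated: "affinely_saturated m K \<or> (trace C = 0 \<and> linearly_saturated m K)"
  shows "{matrix_inv U | U. U \<in> orbit_Cons C m G} = left_translate F (left_stabilizer C)
    \<and> {matrix_inv U | U. U \<in> orbit_Cons C m G}
        = {F' \<in> GL2. left_translate F' (Orb C) = left_translate F (Orb C)}"
proof -
  have Cons_iff: "U \<in> orbit_Cons C m G \<longleftrightarrow>
      U \<in> GL2 \<and> left_translate (matrix_inv U) (Orb C) = left_translate F (Orb C)" for U
  proof (cases "U \<in> GL2")
    case True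
    then have UF: "U ** F \<in> GL2"
      using F_GL2 by (rule GL2_mult)
    have "U \<in> orbit_Cons C m G \<longleftrightarrow> (\<forall>i\<in>{1..m}. (U ** F) ** K i \<in> Orb C)"
      using True G_def by (simp add: orbit_Cons_def matrix_mul_assoc)
    also have "\<dots> \<longleftrightarrow> U ** F \<in> left_stabilizer C"
      using sample_determines_left_stabilizer[OF m_pos K_Orb saturated UF] by simp
    also have "\<dots> \<longleftrightarrow> left_translate U (left_translate F (Orb C)) = Orb C"
      using UF by (simp add: left_stabilizer_def left_translate_mult)
    also have "\<dots> \<longleftrightarrow> left_translate (matrix_inv U) (Orb C) = left_translate F (Orb C)"
      using left_translate_eq_iff[OF True] by auto
    finally show ?thesis
      using True by simp
  qed (simp add: orbit_Cons_def)
  have "{matrix_inv U | U. U \<in> orbit_Cons C m G}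
      = {F' \<in> GL2. left_translate F' (Orb C) = left_translate F (Orb C)}" (is "?L = ?R")
  proof
    show "?L \<subseteq> ?R"
      by (auto simp: Cons_iff GL2_matrix_inv)
    show "?R \<subseteq> ?L"
    proof
      fix F' assume "F' \<in> ?R"
      then have "matrix_inv F' \<in> orbit_Cons C m G" "matrix_inv (matrix_inv F') = F'"
        by (simp_all add: Cons_iff GL2_matrix_inv matrix_inv_matrix_inv_GL2)
      then show "F' \<in> ?L"
        by force
    qed
  qed
  then show ?thesis
    using left_translate_left_stabilizer[OF F_GL2] by simp
qed

end
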